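(* Let $C$ be a parity complex such that $\mu(x)$ is tight for every $x\in C$. Let $(M,P)$ be an $n$-cell and let $u\in M_n$ be such that $(M,P)\neq\langle u\rangle$. Then there exist $m<n$ and cells $(N,Q)$, $(L,R)$, each an $n$-cell of dimension greater than $m$ (i.e. $N\cup Q$ and $L\cup R$ are $n$-dimensional but not $m$-dimensional), such that $(L,R)$ and $(N,Q)$ are $m$-composable and $$(M,P)=(N,Q)*_m(L,R).$$
   Context: A parity complex consists of a set $C=\bigsqcup_{n\ge 0}C_n$ graded by dimension, together with, for each $n\ge 0$ and each $x\in C_{n+1}$, two disjoint, non-empty, finite subsets $x^-,x^+\subseteq C_n$ (for $x\in C_0$ put $x^-=x^+=\emptyset$), subject to Axioms 1, 2, 3A, 3B below. Notation: for $S\subseteq C$, $S^-=\bigcup_{w\in S}w^-$, $S^+=\bigcup_{w\in S}w^+$, $S^\mp=S^-\setminus S^+$, $S^\pm=S^+\setminus S^-$; $x^{-+}=(x^-)^+$, etc.; $S_n=S\cap C_n$, $S^n=\bigcup_{k=0}^n S_k$ ($S^{-1}=\emptyset$); $S$ is $n$-dimensional when $S=S^n$. For $S,T\subseteq C$ write $S\perp T$ when $S^-\cap T^-=\emptyset$ and $S^+\cap T^+=\emptyset$; $x\perp y$ means $\{x\}\perp\{y\}$. A set $S$ is well-formed when $S_0$ has at most one element and for every $n>0$ and all distinct $x,y\in S_n$, $x\perp y$. Write $x<y$ when $x^+\cap y^-\neq\emptyset$, and let $\lhd$ be the reflexive transitive closure of $<$. Axioms: (1) for all $x$, $x^{++}\cup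 x^{--}=x^{-+}\cup x^{+-}$; (2) for all $x$, $x^-$ and $x^+$ are well-formed; (3A) $x\lhd y$ and $y\lhd x$ imply $x=y$; (3B) if $x\lhd y$ then there is no $z$ with $x\in z^+$ and $y\in z^-$, and no $z$ with $y\in z^+$ and $x\in z^-$. For $S,M,P\subseteq C$, $S$ moves $M$ to $P$ when $M=(P\cup S^-)\setminus S^+$ and $P=(M\cup S^+)\setminus S^-$. A cell is a pair $(M,P)$ of non-empty, well-formed, finite subsets of $C$ such that $M$ moves $M$ to $P$ and $P$ moves $M$ to $P$; it is an $n$-cell when $M\cup P$ is $n$-dimensional. For a pair $(M,P)$, its $k$-source and $k$-target are $s_k(M,P)=(M^{k-1}\cup M_k,\ P^{k-1}\cup M_k)$ and $t_k(M,P)=(M^{k-1}\cup P_k,\ P^{k-1}\cup P_k)$. Cells $(L,R)$, $(N,Q)$ are $k$-composable when $t_k(L,R)=s_k(N,Q)$, and then $(N,Q)*_k(L,R)=(L\cup(N\setminus N_k),\ (R\setminus R_k)\cup Q)$. A set $R\subseteq C$ is tight when for all $u,v\in C$, if $u\lhd v$ and $v\in R$ then $u^-\cap R^\pm=\emptyset$. For $x\in C_p$, subsets $\mu(x),\pi(x)\subseteq C^p$ are defined by $\mu(x)_p=\pi(x)_p=\{x\}$, $\mu(x)_{k-1}=(\mu(x)_k)^\mp$ and $\pi(x)_{k-1}=(\pi(x)_k)^\pm$ for $1\le k\le p$ (and $\mu(x)_k=\pi(x)_k=\emptyset$ for $k>p$); write $\langle x\rangle=(\mu(x),\pi(x))$.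 *)

theory Defs
  imports Main
begin

text \<open>A parity complex is given by a carrier set C, a dimension function dim
 (C_n = elements of C of dimension n), and the face maps mi x = x^- and pl x = x^+.\<close>

definition Sminus :: "('a \<Rightarrow> 'a set) \<Rightarrow> 'a set \<Rightarrow> 'a set" where
  "Sminus mi S = (\<Union>w\<in>S. mi w)"

definition Splus :: "('a \<Rightarrow> 'a set) \<Rightarrow> 'a set \<Rightarrow> 'a set" where
  "Splus pl S = (\<Union>w\<in>S. pl w)"

definition Smp :: "('a \<Rightarrow> 'a set) \<Rightarrow> ('a \<Rightarrow> 'a set) \<Rightarrow> 'a set \<Rightarrow> 'a set" where
  "Smp mi pl S = Sminus mi S - Splus pl S"

definition Spm :: "('a \<Rightarrow> 'a set) \<Rightarrow> ('a \<Rightarrow> 'a set) \<Rightarrow> 'a set \<Rightarrow> 'a set" where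
  "Spm mi pl S = Splus pl S - Sminus mi S"

definition level :: "('a \<Rightarrow> nat) \<Rightarrow> 'a set \<Rightarrow> nat \<Rightarrow> 'a set" where
  "level dim S k = {x \<in> S. dim x = k}"

(* S^{k-1}, i.e. elements of dimension < k (so that S^{-1} = {} for k = 0) *)
definition below :: "('a \<Rightarrow> nat) \<Rightarrow> 'a set \<Rightarrow> nat \<Rightarrow> 'a set" where
  "below dim S k = {x \<in> S. dim x < k}"

definition is_ndim :: "('a \<Rightarrow> nat) \<Rightarrow> 'a set \<Rightarrow> nat \<Rightarrow> bool" where
  "is_ndim dim S n \<longleftrightarrow> (\<forall>x\<in>S. dim x \<le> n)"

definition perp :: "('a \<Rightarrow> 'a set) \<Rightarrow> ('a \<Rightarrow> 'a set) \<Rightarrow> 'a set \<Rightarrow> 'a set \<Rightarrow> bool" where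
  "perp mi pl S T \<longleftrightarrow> Sminus mi S \<inter> Sminus mi T = {} \<and> Splus pl S \<inter> Splus pl T = {}"

definition well_formed :: "('a \<Rightarrow> nat) \<Rightarrow> ('a \<Rightarrow> 'a set) \<Rightarrow> ('a \<Rightarrow> 'a set) \<Rightarrow> 'a set \<Rightarrow> bool" where
  "well_formed dim mi pl S \<longleftrightarrow>
     (\<forall>x\<in>S. \<forall>y\<in>S. dim x = 0 \<and> dim y = 0 \<longrightarrow> x = y) \<and>
     (\<forall>x\<in>S. \<forall>y\<in>S. dim x > 0 \<and> dim y = dim x \<and> x \<noteq> y \<longrightarrow> perp mi pl {x} {y})"

definition prec :: "'a set \<Rightarrow> ('a \<Rightarrow> 'a set) \<Rightarrow> ('a \<Rightarrow> 'a set) \<Rightarrow> 'a \<Rightarrow> 'a \<Rightarrow> bool" where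
  "prec C mi pl x y \<longleftrightarrow> x \<in> C \<and> y \<in> C \<and> pl x \<inter> mi y \<noteq> {}"

definition tri :: "'a set \<Rightarrow> ('a \<Rightarrow> 'a set) \<Rightarrow> ('a \<Rightarrow> 'a set) \<Rightarrow> 'a \<Rightarrow> 'a \<Rightarrow> bool" where
  "tri C mi pl = (prec C mi pl)\<^sup>*\<^sup>*"

definition parity_complex ::
  "'a set \<Rightarrow> ('a \<Rightarrow> nat) \<Rightarrow> ('a \<Rightarrow> 'a set) \<Rightarrow> ('a \<Rightarrow> 'a set) \<Rightarrow> bool" where
  "parity_complex C dim mi pl \<longleftrightarrow>
     (\<forall>x\<in>C. dim x = 0 \<longrightarrow> mi x = {} \<and> pl x = {}) \<and>
     (\<forall>x\<in>C. dim x > 0 \<longrightarrow>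
        mi x \<subseteq> C \<and> pl x \<subseteq> C \<and>
        (\<forall>y\<in>mi x \<union> pl x. dim y = dim x - 1) \<and>
        mi x \<inter> pl x = {} \<and> mi x \<noteq> {} \<and> pl x \<noteq> {} \<and> finite (mi x) \<and> finite (pl x)) \<and>
     (\<forall>x\<in>C. Splus pl (pl x) \<union> Sminus mi (mi x) = Splus pl (mi x) \<union> Sminus mi (pl x)) \<and>
     (\<forall>x\<in>C. well_formed dim mi pl (mi x) \<and> well_formed dim mi pl (pl x)) \<and>
     (\<forall>x\<in>C. \<forall>y\<in>C. tri C mi pl x y \<and> tri C mi pl y x \<longrightarrow> x = y) \<and>
     (\<forall>x\<in>C. \<forall>y\<in>C. tri C mi pl x y \<longrightarrow>
        \<not> (\<exists>z\<in>C. x \<in> pl z \<and> y \<in> mi z) \<and> \<not> (\<exists>z\<in>C. y \<in> pl z \<and> x \<in> mi z))"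

definition moves :: "('a \<Rightarrow> 'a set) \<Rightarrow> ('a \<Rightarrow> 'a set) \<Rightarrow> 'a set \<Rightarrow> 'a set \<Rightarrow> 'a set \<Rightarrow> bool" where
  "moves mi pl S M P \<longleftrightarrow>
     M = (P \<union> Sminus mi S) - Splus pl S \<and> P = (M \<union> Splus pl S) - Sminus mi S"

definition is_cell ::
  "'a set \<Rightarrow> ('a \<Rightarrow> nat) \<Rightarrow> ('a \<Rightarrow> 'a set) \<Rightarrow> ('a \<Rightarrow> 'a set) \<Rightarrow> 'a set \<times> 'a set \<Rightarrow> bool" where
  "is_cell C dim mi pl MP \<longleftrightarrow> (case MP of (M, P) \<Rightarrow>
     M \<subseteq> C \<and> P \<subseteq> C \<and> M \<noteq> {} \<and> P \<noteq> {} \<and> finite M \<and> finite P \<and>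
     well_formed dim mi pl M \<and> well_formed dim mi pl P \<and>
     moves mi pl M M P \<and> moves mi pl P M P)"

definition src :: "('a \<Rightarrow> nat) \<Rightarrow> nat \<Rightarrow> 'a set \<times> 'a set \<Rightarrow> 'a set \<times> 'a set" where
  "src dim k MP = (case MP of (M, P) \<Rightarrow>
     (below dim M k \<union> level dim M k, below dim P k \<union> level dim M k))"

definition tgt :: "('a \<Rightarrow> nat) \<Rightarrow> nat \<Rightarrow> 'a set \<times> 'a set \<Rightarrow> 'a set \<times> 'a set" where
  "tgt dim k MP = (case MP of (M, P) \<Rightarrow>
     (below dim M k \<union> level dim P k, below dim P k \<union> level dim P k))"

definition comp :: "('a \<Rightarrow> nat) \<Rightarrow> nat \<Rightarrow> 'a set \<times> 'a set \<Rightarrow> 'a set \<times> 'a set \<Rightarrow> 'a set \<times> 'a set" where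
  "comp dim k NQ LR = (case NQ of (N, Q) \<Rightarrow> case LR of (L, R) \<Rightarrow>
     (L \<union> (N - level dim N k), (R - level dim R k) \<union> Q))"

definition tight :: "'a set \<Rightarrow> ('a \<Rightarrow> 'a set) \<Rightarrow> ('a \<Rightarrow> 'a set) \<Rightarrow> 'a set \<Rightarrow> bool" where
  "tight C mi pl R \<longleftrightarrow>
     (\<forall>u\<in>C. \<forall>v\<in>C. tri C mi pl u v \<and> v \<in> R \<longrightarrow> mi u \<inter> Spm mi pl R = {})"

(* \<mu>(x)_k = (\<mu>(x)_{k+1})^\<mp>, \<mu>(x)_p = {x}; so \<mu>(x)_k is the (p-k)-fold iterate of ^\<mp> on {x} *)
definition mu :: "('a \<Rightarrow> nat) \<Rightarrow> ('a \<Rightarrow> 'a set) \<Rightarrow> ('a \<Rightarrow> 'a set) \<Rightarrow> 'a \<Rightarrow> 'a set" where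
  "mu dim mi pl x = {y. dim y \<le> dim x \<and> y \<in> (Smp mi pl ^^ (dim x - dim y)) {x}}"

definition pi :: "('a \<Rightarrow> nat) \<Rightarrow> ('a \<Rightarrow> 'a set) \<Rightarrow> ('a \<Rightarrow> 'a set) \<Rightarrow> 'a \<Rightarrow> 'a set" where
  "pi dim mi pl x = {y. dim y \<le> dim x \<and> y \<in> (Spm mi pl ^^ (dim x - dim y)) {x}}"

end

(*
  Excision of extremals.  Let j be the largest dimension in which (M,P) differs from <u>.  Above
  j the two agree, so M_j contains mu(u)_j, and the excess M_j - mu(u)_j = P_j - pi(u)_j is a set
  of common elements of M and P.  For j = 0 it is empty, because M_0 is a singleton and
  mu(u)_0 is not empty; hence j = m + 1.  From w in the excess go down, respectively up, inside
  M_j along < to a minimal x and a maximal y.  If both belonged to mu(u), then on the way from x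
  to w one would leave mu(u) through some z < z' with a common face e in (mu(u)^+ - mu(u)^-),
  contradicting tightness at z' <| y.  Whichever of x, y lies outside mu(u) is split off as
  the first, respectively last, factor of an m-composite.

  The factors are cells because a positive move of a cell along an element x of dimension m + 1,
  with x^- in the top level S, is again a cell.  This is proved by induction on m: elements
  of S outside x^- cannot touch the internal faces of x^+, since otherwise S could be cut so
  that x^+ is applied, one dimension lower, to a set already containing such a face.
*)

theory Submission
  imports Defs
begin

locale parity =
  fixes C :: "'a set" and dim :: "'a \<Rightarrow> nat" and mi pl :: "'a \<Rightarrow> 'a set"
  assumes pc: "parity_complex C dim mi pl"
begin

section \<open>Faces and the axioms\<close>

abbreviation "Neg \<equiv> Sminus mi"
abbreviation "Pos \<equiv> Splus pl"
abbreviation "wf_set \<equiv> well_formed dim mi pl"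
abbreviation mvs where "mvs \<equiv> moves mi pl"
abbreviation lv where "lv \<equiv> level dim"
abbreviation precC (infix "\<prec>" 50) where "x \<prec> y \<equiv> prec C mi pl x y"
abbreviation triC (infix "\<unlhd>" 50) where "x \<unlhd> y \<equiv> tri C mi pl x y"

lemma in_Neg: "e \<in> Neg S \<longleftrightarrow> (\<exists>w\<in>S. e \<in> mi w)"
  and in_Pos: "e \<in> Pos S \<longleftrightarrow> (\<exists>w\<in>S. e \<in> pl w)"
  by (auto simp: Sminus_def Splus_def)

lemmas axioms = pc[unfolded parity_complex_def]
lemmas axiom_dim0 = axioms[THEN conjunct1, rule_format]
lemmas axiom_faces = axioms[THEN conjunct2, THEN conjunct1, rule_format]
lemmas axiom1 = axioms[THEN conjunct2, THEN conjunct2, THEN conjunct1, rule_format]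
lemmas axiom2 = axioms[THEN conjunct2, THEN conjunct2, THEN conjunct2, THEN conjunct1, rule_format]
lemmas axiom3 = axioms[THEN conjunct2, THEN conjunct2, THEN conjunct2, THEN conjunct2]
lemmas axiom3A = axiom3[THEN conjunct1]
lemmas axiom3B = axiom3[THEN conjunct2]

lemma face_pos:
  assumes "x \<in> C" "dim x > 0"
  shows "mi x \<inter> pl x = {}" "mi x \<noteq> {}" "pl x \<noteq> {}" "finite (mi x)" "finite (pl x)"
  using axiom_faces[OF assms] by simp_all

lemma face:
  assumes "x \<in> C" "y \<in> mi x \<union> pl x"
  shows "y \<in> C" "dim x = Suc (dim y)"
proof -
  have pos: "dim x > 0" using assms axiom_dim0[of x] by (cases "dim x = 0") auto
  have *: "mi x \<subseteq> C" "pl x \<subseteq> C" "\<forall>y\<in>mi x \<union> pl x. dim y = dim x - 1"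
    using axiom_faces[OF assms(1) pos] by simp_all
  show "y \<in> C" using * assms(2) by blast
  have "dim y = dim x - 1" using * assms(2) by blast
  then show "dim x = Suc (dim y)" using pos by simp
qed

lemma face_dim:
  assumes "x \<in> C" "dim x = Suc d"
  shows "mi x \<subseteq> C" "pl x \<subseteq> C" "y \<in> mi x \<Longrightarrow> dim y = d" "y \<in> pl x \<Longrightarrow> dim y = d"
  using face[OF assms(1)] assms(2) by (auto dest: sym)

lemma face_disjoint: "x \<in> C \<Longrightarrow> mi x \<inter> pl x = {}"
  using axiom_dim0[of x] face_pos(1)[of x] by (cases "dim x = 0") auto

lemma wf_face: "x \<in> C \<Longrightarrow> wf_set (mi x)" "x \<in> C \<Longrightarrow> wf_set (pl x)"
  using axiom2 by simp_all

lemma tri_antisym: "x \<in> C \<Longrightarrow> y \<in> C \<Longrightarrow> x \<unlhd> y \<Longrightarrow> y \<unlhd> x \<Longrightarrow> x = y"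
  by (rule axiom3A[rule_format]) simp_all

lemma not_tri_faces:
  assumes "z \<in> C" "a \<in> mi z" "b \<in> pl z"
  shows "\<not> a \<unlhd> b" "\<not> b \<unlhd> a"
proof -
  have C: "a \<in> C" "b \<in> C" using face assms by auto
  show "\<not> a \<unlhd> b" "\<not> b \<unlhd> a"
    using axiom3B[THEN bspec, THEN bspec, OF C] axiom3B[THEN bspec, THEN bspec, OF C(2,1)] assms
    by blast+
qed

section \<open>Duality: reversing the sign of all faces\<close>

lemma prec_dual: "prec C pl mi x y \<longleftrightarrow> y \<prec> x"
  by (auto simp: prec_def)

lemma wf_dual: "well_formed dim pl mi S = wf_set S"
proof -
  have "perp pl mi A B = perp mi pl A B" for A B
    unfolding perp_def Sminus_def Splus_def by (rule conj_commute)
  then show ?thesis unfolding well_formed_def by simp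
qed

lemma moves_dual: "moves pl mi S A B \<longleftrightarrow> mvs S B A"
  unfolding moves_def Sminus_def Splus_def by (rule conj_commute)

text \<open>Axioms 1, 3A and 3B are symmetric under exchanging the signs, with \<unlhd> replaced by
  its converse. Facts about targets, \<open>pi\<close> and minimal elements are obtained from their
  counterparts through this instance.\<close>

lemma dual: "parity C dim pl mi"
proof
  have "prec C pl mi = (prec C mi pl)\<inverse>\<inverse>"
    by (intro ext) (simp add: prec_dual)
  then have tri: "tri C pl mi x y = tri C mi pl y x" for x y
    by (simp add: tri_def rtranclp_conversep)
  show "parity_complex C dim pl mi"
    unfolding parity_complex_def tri wf_dual
  proof (intro conjI ballI impI)
    show "pl x = {}" "mi x = {}" if "x \<in> C" "dim x = 0" for x
      using axiom_dim0[OF that] by simp_all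
    show "pl x \<subseteq> C" "mi x \<subseteq> C" if "x \<in> C" for x
      using face[OF that] by blast+
    show "dim y = dim x - 1" if "x \<in> C" "y \<in> pl x \<union> mi x" for x y
      using face[of x y] that by auto
    show "pl x \<inter> mi x = {}" "pl x \<noteq> {}" "mi x \<noteq> {}" "finite (pl x)" "finite (mi x)"
      if "x \<in> C" "0 < dim x" for x
      using face_pos[OF that] by auto
    show "Splus mi (mi x) \<union> Sminus pl (pl x) = Splus mi (pl x) \<union> Sminus pl (mi x)"
      if "x \<in> C" for x
      using axiom1[OF that] unfolding Sminus_def Splus_def by (simp only: Un_commute)
    show "wf_set (pl x)" "wf_set (mi x)" if "x \<in> C" for x
      using wf_face[OF that] by blast+
    show "x = y" if "x \<in> C" "y \<in> C" "y \<unlhd> x \<and> x \<unlhd> y" for x y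
      using tri_antisym that by blast
    show "\<not> (\<exists>z\<in>C. x \<in> mi z \<and> y \<in> pl z)" "\<not> (\<exists>z\<in>C. y \<in> mi z \<and> x \<in> pl z)"
      if "y \<unlhd> x" for x y
      using not_tri_faces that by blast+
  qed
qed

lemma cell_dual: "is_cell C dim mi pl (M, P) \<Longrightarrow> is_cell C dim pl mi (P, M)"
  unfolding is_cell_def wf_dual moves_dual prod.case by (elim conjE, intro conjI)

section \<open>The order \<unlhd>, shared faces and maximal elements\<close>

lemma precI: "x \<in> C \<Longrightarrow> y \<in> C \<Longrightarrow> e \<in> pl x \<Longrightarrow> e \<in> mi y \<Longrightarrow> x \<prec> y"
  by (auto simp: prec_def)

lemma prec_tri: "x \<prec> y \<Longrightarrow> x \<unlhd> y"
  by (simp add: tri_def)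

lemma tri_refl: "x \<unlhd> x"
  by (simp add: tri_def)

lemma tri_trans: "x \<unlhd> y \<Longrightarrow> y \<unlhd> z \<Longrightarrow> x \<unlhd> z"
  by (simp add: tri_def)

lemma prec_not_tri: "x \<prec> y \<Longrightarrow> \<not> y \<unlhd> x"
proof
  assume xy: "x \<prec> y" and "y \<unlhd> x"
  then have "x = y" "x \<in> C"
    using tri_antisym prec_tri by (auto simp: prec_def)
  then show False using xy face_disjoint by (auto simp: prec_def)
qed

text \<open>A common element would give a relation \<prec> between an element of \<open>mi x\<close>
  and one of \<open>pl x\<close>, which Axiom 3B forbids.\<close>

lemma faces_disjoint2:
  assumes "x \<in> C"
  shows "Pos (pl x) \<inter> Neg (mi x) = {}" "Pos (mi x) \<inter> Neg (pl x) = {}"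
proof -
  have *: "a \<unlhd> b" if "a \<in> mi x \<union> pl x" "b \<in> mi x \<union> pl x" "e \<in> pl a" "e \<in> mi b" for a b e
    using that face(1)[OF assms] by (intro prec_tri precI[of a b e])
  show "Pos (pl x) \<inter> Neg (mi x) = {}" "Pos (mi x) \<inter> Neg (pl x) = {}"
    using not_tri_faces[OF assms] * unfolding disjoint_iff in_Neg in_Pos by (meson UnI1 UnI2)+
qed

text \<open>By Axiom 1 and the disjointness above, both sides equal
  \<open>Neg (mi x) \<inter> Neg (pl x)\<close>. Hence whatever \<open>mi x\<close> needs from
  below, \<open>pl x\<close> needs as well.\<close>

lemma Neg_Pos_faces:
  assumes "x \<in> C"
  shows "Neg (pl x) - Pos (pl x) = Neg (mi x) - Pos (mi x)"
  using faces_disjoint2[OF assms] axiom1[OF assms] by blast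

lemma wf_unique:
  assumes "wf_set S" "a \<in> S" "b \<in> S" "a \<in> C" "b \<in> C"
    and "e \<in> mi a \<and> e \<in> mi b \<or> e \<in> pl a \<and> e \<in> pl b"
  shows "a = b"
proof (rule ccontr)
  assume "a \<noteq> b"
  moreover have "dim a = Suc (dim e)" "dim b = Suc (dim e)"
    using face(2) assms(4-6) by blast+
  ultimately have "perp mi pl {a} {b}"
    using assms(1-3) unfolding well_formed_def by (metis zero_less_Suc)
  then show False using assms(6) unfolding perp_def Sminus_def Splus_def by auto
qed

lemma wf_subset: "wf_set S \<Longrightarrow> T \<subseteq> S \<Longrightarrow> wf_set T"
  unfolding well_formed_def by blast

lemma finite_has_prec_maximal:
  assumes "finite D" "D \<noteq> {}" "D \<subseteq> C"
  shows "\<exists>s\<in>D. \<forall>b\<in>D. \<not> s \<prec> b"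
proof (rule ccontr)
  assume neg: "\<not> ?thesis"
  let ?r = "{(b, s). s \<in> D \<and> b \<in> D \<and> s \<prec> b}"
  \<comment> \<open>The edge into \<open>b\<close> is kept strict: a cycle through \<open>b\<close>
    would yield \<open>c \<prec> b\<close> and \<open>b \<unlhd> c\<close>, against Axiom
    3A.\<close>
  have tri: "(b, s) \<in> ?r\<^sup>+ \<Longrightarrow> \<exists>c. c \<prec> b \<and> s \<unlhd> c" for b s
  proof (induction rule: trancl_induct)
    case (base y)
    then have "y \<prec> b" by simp
    then show ?case using tri_refl by blast
  next
    case (step y z)
    then have "z \<prec> y" by simp
    then show ?case using step.IH prec_tri tri_trans by blast
  qed
  have "finite ?r" by (rule finite_subset[of _ "D \<times> D"]) (use assms in auto)
  moreover have "acyclic ?r" using tri prec_not_tri unfolding acyclic_def by blast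
  ultimately have "wf ?r" by (rule finite_acyclic_wf)
  then obtain s where "s \<in> D" "\<And>b. (b, s) \<in> ?r \<Longrightarrow> b \<notin> D"
    using wfE_min' assms(2) by blast
  then show False using neg by blast
qed

section \<open>Positive moves of a cell along one element\<close>

text \<open>The predicate \<open>K\<close> will be "\<open>A\<close> is the common top level of a \<open>d\<close>-cell with given lower
  part". The elements of \<open>D\<close> are applied to \<open>A\<close> one at a time, a maximal one last.\<close>

lemma move_downset:
  assumes step: "\<And>A x. K A \<Longrightarrow> x \<in> C \<Longrightarrow> dim x = Suc d \<Longrightarrow> mi x \<subseteq> A
      \<Longrightarrow> pl x \<inter> A = {} \<and> K ((A \<union> pl x) - mi x)"
    and S: "finite S" "S \<subseteq> C" "\<And>s. s \<in> S \<Longrightarrow> dim s = Suc d" "wf_set S"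
    and A: "K A" "Neg S - Pos S \<subseteq> A"
    and D: "D \<subseteq> S" "\<And>a b. a \<in> D \<Longrightarrow> b \<in> S \<Longrightarrow> b \<prec> a \<Longrightarrow> b \<in> D"
  shows "Pos D \<inter> A = {} \<and> K ((A \<union> Pos D) - Neg D)"
proof -
  have "finite D" using D(1) S(1) finite_subset by blast
  then show ?thesis using D
  proof (induction D rule: finite_psubset_induct)
    case (psubset D)
    show ?case
    proof (cases "D = {}")
      case True
      then show ?thesis using A by (simp add: Sminus_def Splus_def)
    next
      case False
      then obtain s where s: "s \<in> D" "\<And>b. b \<in> D \<Longrightarrow> \<not> s \<prec> b"
        using finite_has_prec_maximal psubset.hyps psubset.prems(1) S(2)
        by (metis subset_trans)
      define D' where "D' = D - {s}"
      have DC: "D \<subseteq> C" using psubset.prems(1) S(2) by blast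
      have uniq: "a = b" if "e \<in> mi a" "e \<in> mi b" "a \<in> S" "b \<in> S" for a b e
        using wf_unique[OF S(4)] that S(2) by blast
      have IH: "Pos D' \<inter> A = {} \<and> K ((A \<union> Pos D') - Neg D')"
      proof (rule psubset.IH)
        show "D' \<subset> D" "D' \<subseteq> S" using s psubset.prems(1) by (auto simp: D'_def)
        show "b \<in> D'" if "a \<in> D'" "b \<in> S" "b \<prec> a" for a b
          using that psubset.prems(2)[of a b] s by (auto simp: D'_def)
      qed
      have "mi s \<subseteq> (A \<union> Pos D') - Neg D'"
      proof
        fix f assume f: "f \<in> mi s"
        have sS: "s \<in> S" using s psubset.prems(1) by blast
        have "f \<notin> Neg D'"
          using uniq[OF f] sS psubset.prems(1) by (auto simp: in_Neg D'_def)
        moreover have "f \<in> A \<union> Pos D'"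
        proof (cases "f \<in> Pos S")
          case True
          then obtain b where b: "b \<in> S" "f \<in> pl b" by (auto simp: in_Pos)
          then have "b \<prec> s" using f sS S(2) precI by blast
          then have "b \<in> D'"
            using psubset.prems(2)[OF s(1) b(1)] prec_not_tri tri_refl by (auto simp: D'_def)
          then show ?thesis using b by (auto simp: in_Pos)
        next
          case False
          then have "f \<in> Neg S - Pos S" using f sS by (auto simp: in_Neg)
          then show ?thesis using A(2) by blast
        qed
        ultimately show "f \<in> (A \<union> Pos D') - Neg D'" by blast
      qed
      then have st: "pl s \<inter> ((A \<union> Pos D') - Neg D') = {} \<and>
          K (((A \<union> Pos D') - Neg D' \<union> pl s) - mi s)"
        using step IH s(1) DC S(3) psubset.prems(1) by blast
      \<comment> \<open>By maximality nothing in \<open>D\<close> consumes a positive face of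
        \<open>s\<close>, so moving along \<open>D'\<close> and then along \<open>s\<close> is the
        same as moving along \<open>D\<close> at once.\<close>
      have disj: "pl s \<inter> Neg D = {}"
        unfolding disjoint_iff in_Neg using s DC precI by blast
      have ND: "Neg D = Neg D' \<union> mi s" "Pos D = Pos D' \<union> pl s"
        using s(1) by (auto simp: D'_def Sminus_def Splus_def)
      have "((A \<union> Pos D') - Neg D' \<union> pl s) - mi s = (A \<union> Pos D) - Neg D"
        using disj ND by blast
      moreover have "Pos D \<inter> A = {}"
        using st IH disj ND by blast
      ultimately show ?thesis using st by simp
    qed
  qed
qed

text \<open>Cut \<open>S\<close> just before \<open>x\<^sup>-\<close>, but keep any element producing \<open>e\<close> in the first part \<open>D\<close>. Moving
  \<open>A\<close> along \<open>D\<close> gives \<open>A'\<close> with \<open>e \<in> A'\<close>. As \<open>x\<^sup>+\<close> has the same outer negative faces as \<open>x\<^sup>-\<close>, it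
  can be applied to \<open>A'\<close>, so its positive faces avoid \<open>A'\<close>. By Axiom 3B, \<open>D\<close> is
  downward closed in \<open>S\<close>.\<close>

lemma internal_avoids:
  assumes step: "\<And>A x. K A \<Longrightarrow> x \<in> C \<Longrightarrow> dim x = Suc d \<Longrightarrow> mi x \<subseteq> A
      \<Longrightarrow> pl x \<inter> A = {} \<and> K ((A \<union> pl x) - mi x)"
    and S: "finite S" "S \<subseteq> C" "\<And>s. s \<in> S \<Longrightarrow> dim s = Suc d" "wf_set S"
    and A: "K A" "mvs S A B"
    and x: "x \<in> C" "dim x = Suc (Suc d)" "mi x \<subseteq> S"
    and e: "e \<in> Neg (pl x)" "e \<in> Pos (pl x)"
  shows "e \<notin> A \<union> Pos S \<union> Neg S"
proof
  assume "e \<in> A \<union> Pos S \<union> Neg S"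
  then have eA: "e \<in> A \<union> Pos S" using A(2) unfolding moves_def by blast+
  have SA: "Neg S - Pos S \<subseteq> A" "A \<inter> Pos S = {}" using A(2) unfolding moves_def by blast+
  obtain t t' where t: "t \<in> pl x" "e \<in> mi t" "t' \<in> pl x" "e \<in> pl t'"
    using e by (auto simp: in_Neg in_Pos)
  have tC: "t \<in> C" "t' \<in> C" using t face x by auto
  define V where "V = mi x \<union> {v \<in> S. e \<in> pl v}"
  define D where "D = {s \<in> S - mi x. \<exists>v\<in>V. s \<unlhd> v}"
  have uniq: "a = b" if "f \<in> mi a \<and> f \<in> mi b \<or> f \<in> pl a \<and> f \<in> pl b" "a \<in> S" "b \<in> S" for a b f
    using wf_unique[OF S(4)] that S(2) by blast
  have notV: False if "v \<in> mi x" "v \<unlhd> w" "w \<in> S" "e \<in> pl w" for v w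
  proof -
    have "w \<prec> t" using that t tC S(2) precI by blast
    then show False using that not_tri_faces(1)[OF x(1) _ t(1)] prec_tri tri_trans by blast
  qed
  have down: "b \<in> D" if ab: "a \<in> D" "b \<in> S" "b \<prec> a" for a b
  proof -
    obtain v where v: "v \<in> V" "a \<unlhd> v" "a \<in> S" "a \<notin> mi x" using ab(1) unfolding D_def by blast
    have "b \<notin> mi x"
    proof
      assume b: "b \<in> mi x"
      \<comment> \<open>Well-formedness of \<open>S\<close> keeps \<open>f\<close> out of
        \<open>Neg (mi x)\<close>, so Axiom 1 makes \<open>f\<close> a positive face of some
        \<open>r \<in> pl x\<close>. Then \<open>r \<unlhd> v\<close> excludes
        \<open>v \<in> mi x\<close> by Axiom 3B, while \<open>b \<unlhd> v\<close> excludes that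
        \<open>v\<close> produces \<open>e\<close>.\<close>
      obtain f where f: "f \<in> pl b" "f \<in> mi a" using ab(3) unfolding prec_def by blast
      have "f \<notin> Neg (mi x)"
        using uniq[of f a] f(2) v(3,4) x(3) unfolding in_Neg by blast
      moreover have "f \<in> Pos (mi x)" using b f by (auto simp: in_Pos)
      ultimately have "f \<in> Pos (pl x)"
        using axiom1[OF x(1)] faces_disjoint2[OF x(1)] by blast
      then obtain r where r: "r \<in> pl x" "f \<in> pl r" by (auto simp: in_Pos)
      have "r \<in> C" using face(1)[OF x(1)] r by blast
      then have "r \<prec> a" using precI[of r a f] f r v(3) S(2) by blast
      then have rv: "r \<unlhd> v" using tri_trans[OF prec_tri v(2)] by blast
      have bv: "b \<unlhd> v" using tri_trans[OF prec_tri v(2)] ab(3) by blast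
      have "v \<notin> mi x" using not_tri_faces(2)[OF x(1) _ r(1)] rv by blast
      then show False
        using v(1) notV[OF b bv] by (simp add: V_def)
    qed
    moreover have "b \<unlhd> v" using tri_trans[OF prec_tri v(2)] ab(3) by blast
    ultimately show ?thesis using ab(2) v(1) unfolding D_def by blast
  qed
  have DS: "D \<subseteq> S" by (auto simp: D_def)
  define A' where "A' = (A \<union> Pos D) - Neg D"
  have KA': "K A'"
    unfolding A'_def by (rule move_downset[OF step S A(1) SA(1) DS down, THEN conjunct2])
  have "Neg (mi x) - Pos (mi x) \<subseteq> A'"
  proof
    fix f assume f: "f \<in> Neg (mi x) - Pos (mi x)"
    then obtain v where v: "v \<in> mi x" "f \<in> mi v" by (auto simp: in_Neg)
    have "f \<notin> Neg D" using uniq[of f _ v] v x(3) unfolding in_Neg D_def by blast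
    moreover have "f \<in> A \<union> Pos D"
    proof (cases "f \<in> Pos S")
      case True
      then obtain b where b: "b \<in> S" "f \<in> pl b" by (auto simp: in_Pos)
      then have "b \<unlhd> v" using v x(3) S(2) precI[of b v f] prec_tri by blast
      moreover have "b \<notin> mi x" using b f by (auto simp: in_Pos)
      ultimately have "b \<in> D" using b v unfolding D_def V_def by blast
      then show ?thesis using b by (auto simp: in_Pos)
    next
      case False
      moreover have "f \<in> Neg S" using v x(3) by (auto simp: in_Neg)
      ultimately show ?thesis using SA by blast
    qed
    ultimately show "f \<in> A'" by (simp add: A'_def)
  qed
  then have "Neg (pl x) - Pos (pl x) \<subseteq> A'"
    using Neg_Pos_faces[OF x(1)] by simp
  moreover have plx: "finite (pl x)" "pl x \<subseteq> C" "\<And>t. t \<in> pl x \<Longrightarrow> dim t = Suc d"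
    using face_pos(5)[OF x(1)] face_dim[OF x(1,2)] x(2) by simp_all
  ultimately have "Pos (pl x) \<inter> A' = {}"
    by (intro move_downset[OF step plx wf_face(2)[OF x(1)] KA' _ order_refl, THEN conjunct1])
  moreover have "e \<in> A'"
  proof -
    have "e \<in> A \<union> Pos D"
    proof (cases "e \<in> Pos S")
      case True
      then obtain s where s: "s \<in> S" "e \<in> pl s" by (auto simp: in_Pos)
      have "s \<notin> mi x" using notV[OF _ tri_refl s] by blast
      then have "s \<in> D" using s tri_refl unfolding D_def V_def by blast
      then show ?thesis using s by (auto simp: in_Pos)
    qed (use eA in auto)
    \<comment> \<open>If \<open>s \<in> D\<close> consumed \<open>e\<close>, then either
      \<open>t' \<prec> s \<unlhd> v\<close> with \<open>v \<in> mi x\<close>, against Axiom 3B, or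
      \<open>v\<close> produces \<open>e\<close> and \<open>v \<prec> s \<unlhd> v\<close>.\<close>
    moreover have "e \<notin> Neg D"
    proof
      assume "e \<in> Neg D"
      then obtain s v where s: "s \<in> S" "v \<in> V" "s \<unlhd> v" "e \<in> mi s"
        unfolding in_Neg D_def by blast
      have sC: "s \<in> C" using s S(2) by blast
      show False
      proof (cases "v \<in> mi x")
        case True
        have "t' \<unlhd> v" using precI[OF tC(2) sC t(4) s(4)] prec_tri s(3) tri_trans by blast
        then show False using not_tri_faces(2)[OF x(1) True t(3)] by blast
      next
        case False
        then have "v \<prec> s" using s(2,4) sC S(2) precI[of v s e] unfolding V_def by blast
        then show False using s prec_not_tri by blast
      qed
    qed
    ultimately show ?thesis by (simp add: A'_def)
  qed
  ultimately show False using e by blast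
qed

text \<open>Faces internal to \<open>pl x\<close> meet nothing else by \<open>int\<close>, and Axiom
  1 controls the others, so exchanging \<open>mi x\<close> for \<open>pl x\<close> leaves the net
  effect on \<open>A\<close> and \<open>B\<close> unchanged.\<close>

lemma replace_face:
  assumes S: "finite S" "S \<subseteq> C" "\<And>s. s \<in> S \<Longrightarrow> dim s = Suc d" "wf_set S"
    and A: "mvs S A B"
    and x: "x \<in> C" "dim x = Suc (Suc d)" "mi x \<subseteq> S"
    and int: "\<And>e. e \<in> Neg (pl x) \<Longrightarrow> e \<in> Pos (pl x) \<Longrightarrow> e \<notin> A \<union> Pos S \<union> Neg S"
  shows "pl x \<inter> S = {}" "wf_set ((S \<union> pl x) - mi x)" "mvs ((S \<union> pl x) - mi x) A B"
proof -
  let ?Y = "(S \<union> pl x) - mi x"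
  define S0 where "S0 = S - mi x"
  have dimpl: "t \<in> C \<and> dim t = Suc d" if "t \<in> pl x" for t
    using that face[OF x(1), of t] x(2) by auto
  have uniq: "a = b" if "f \<in> mi a \<and> f \<in> mi b \<or> f \<in> pl a \<and> f \<in> pl b" "a \<in> S" "b \<in> S" for a b f
    using wf_unique[OF S(4)] that S(2) by blast
  have n0: "Neg S0 \<inter> Neg (mi x) = {}" "Pos S0 \<inter> Pos (mi x) = {}"
    using uniq x(3) unfolding in_Neg in_Pos S0_def disjoint_iff by blast+
  have split: "Neg S = Neg S0 \<union> Neg (mi x)" "Pos S = Pos S0 \<union> Pos (mi x)"
    using x(3) unfolding S0_def Sminus_def Splus_def by blast+
  have Y: "?Y = S0 \<union> pl x" "Neg ?Y = Neg S0 \<union> Neg (pl x)" "Pos ?Y = Pos S0 \<union> Pos (pl x)"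
    using face_disjoint[OF x(1)] unfolding S0_def Sminus_def Splus_def by blast+
  note ax = axiom1[OF x(1)] faces_disjoint2[OF x(1)]
  \<comment> \<open>By Axiom 1 a common face is either internal to \<open>pl x\<close>, excluded by
    \<open>int\<close>, or a face of the same sign of \<open>mi x\<close>, excluded by
    \<open>n0\<close>.\<close>
  have n1: "Neg S0 \<inter> Neg (pl x) = {}" "Pos S0 \<inter> Pos (pl x) = {}"
    using int n0 split ax by blast+
  show "pl x \<inter> S = {}"
  proof (rule ccontr)
    assume "pl x \<inter> S \<noteq> {}"
    then obtain s where s: "s \<in> pl x" "s \<in> S0"
      using face_disjoint[OF x(1)] by (auto simp: S0_def)
    then have "mi s \<noteq> {}" using dimpl face_pos(2) by auto
    then show False using s n1(1) unfolding disjoint_iff in_Neg by blast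
  qed
  have mixed: "perp mi pl {s} {t}" "perp mi pl {t} {s}" if "s \<in> S0" "t \<in> pl x" for s t
    using n1 that unfolding perp_def disjoint_iff in_Neg in_Pos by blast+
  show "wf_set ?Y"
    unfolding Y(1) well_formed_def
  proof (intro conjI ballI impI)
    fix a b assume ab: "a \<in> S0 \<union> pl x" "b \<in> S0 \<union> pl x"
    have "dim a > 0" using ab dimpl S(3) by (auto simp: S0_def)
    then show "dim a = 0 \<and> dim b = 0 \<Longrightarrow> a = b" by simp
    assume "0 < dim a \<and> dim b = dim a \<and> a \<noteq> b"
    then show "perp mi pl {a} {b}"
      using ab mixed S(4) wf_face(2)[OF x(1)] unfolding well_formed_def S0_def by blast
  qed
  have bool: "e \<in> A \<longleftrightarrow> (e \<in> B \<or> e \<in> Neg S0 \<or> e \<in> Neg (mi x)) \<and> \<not> (e \<in> Pos S0 \<or> e \<in> Pos (mi x))"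
    "e \<in> B \<longleftrightarrow> (e \<in> A \<or> e \<in> Pos S0 \<or> e \<in> Pos (mi x)) \<and> \<not> (e \<in> Neg S0 \<or> e \<in> Neg (mi x))" for e
    using A unfolding moves_def split by blast+
  show "mvs ?Y A B"
    unfolding moves_def Y(2,3)
  proof (intro conjI set_eqI)
    fix e
    have 1: "e \<in> Neg (pl x) \<Longrightarrow> e \<in> Pos (pl x) \<Longrightarrow>
      e \<notin> A \<and> e \<notin> Neg S0 \<and> e \<notin> Pos S0 \<and> e \<notin> Neg (mi x) \<and> e \<notin> Pos (mi x)"
      using int[of e] split by blast
    show "e \<in> A \<longleftrightarrow> e \<in> B \<union> (Neg S0 \<union> Neg (pl x)) - (Pos S0 \<union> Pos (pl x))"
      using 1 bool[of e] n0 ax by blast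
    show "e \<in> B \<longleftrightarrow> e \<in> A \<union> (Pos S0 \<union> Pos (pl x)) - (Neg S0 \<union> Neg (pl x))"
      using 1 bool[of e] n0 ax by blast
  qed
qed

text \<open>\<open>pcell M P d S\<close> says that the levels \<open>M 0, \<dots>, M (d - 1)\<close>, \<open>P 0, \<dots>, P (d - 1)\<close> together
  with the common top level \<open>S\<close> form a \<open>d\<close>-cell. The top level varies in the induction below
  while the rest is fixed.\<close>

primrec pcell :: "(nat \<Rightarrow> 'a set) \<Rightarrow> (nat \<Rightarrow> 'a set) \<Rightarrow> nat \<Rightarrow> 'a set \<Rightarrow> bool" where
  "pcell M P 0 S \<longleftrightarrow> (\<exists>a\<in>C. dim a = 0 \<and> S = {a})"
| "pcell M P (Suc d) S \<longleftrightarrow>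
     finite S \<and> S \<subseteq> C \<and> (\<forall>s\<in>S. dim s = Suc d) \<and> wf_set S \<and>
     mvs S (M d) (P d) \<and> pcell M P d (M d) \<and> pcell M P d (P d)"

text \<open>In dimension 0, \<open>S\<close> is a point, and well-formedness makes
  \<open>pl x\<close> a single point too. In the successor case the induction hypothesis serves as
  the hypothesis \<open>step\<close> of \<open>internal_avoids\<close>. Disjointness belongs to the
  induction because one dimension higher it is what keeps internal faces away.\<close>

lemma pcell_step:
  "pcell M P d S \<Longrightarrow> x \<in> C \<Longrightarrow> dim x = Suc d \<Longrightarrow> mi x \<subseteq> S
    \<Longrightarrow> pl x \<inter> S = {} \<and> pcell M P d ((S \<union> pl x) - mi x)"
proof (induction d arbitrary: S x)
  case 0
  then obtain a where a: "S = {a}" by auto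
  then have mx: "mi x = {a}" using 0 face_pos(2) by (metis subset_singletonD zero_less_Suc)
  obtain b where b: "b \<in> pl x" using face_pos(3)[of x] 0 by auto
  have d0: "c \<in> C \<and> dim c = 0" if "c \<in> pl x" for c using face[of x c] that 0 by auto
  have "pl x = {b}"
    using d0 b wf_face(2)[OF 0(2)] unfolding well_formed_def by blast
  moreover have "a \<noteq> b" using face_disjoint[OF 0(2)] b mx by auto
  ultimately show ?case using a mx d0 b by auto
next
  case (Suc d)
  then have S: "finite S" "S \<subseteq> C" "\<And>s. s \<in> S \<Longrightarrow> dim s = Suc d" "wf_set S"
    and A: "pcell M P d (M d)" "mvs S (M d) (P d)" by auto
  have int: "e \<notin> M d \<union> Pos S \<union> Neg S" if "e \<in> Neg (pl x)" "e \<in> Pos (pl x)" for e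
    using internal_avoids[of "pcell M P d", OF Suc.IH S A] Suc.prems that by blast
  note R = replace_face[OF S A(2) Suc.prems(2-4) int]
  have "t \<in> C \<and> dim t = Suc d" if "t \<in> pl x" for t
    using face[OF Suc.prems(2), of t] Suc.prems(3) that by auto
  moreover have "finite (pl x)"
    using Suc.prems(3) face_pos(5)[OF Suc.prems(2)] by simp
  ultimately show ?case using R Suc.prems(1) by auto
qed

section \<open>Cells as families of levels\<close>

lemma movesD:
  assumes "mvs S A B"
  shows "e \<in> A \<longleftrightarrow> (e \<in> B \<or> e \<in> Neg S) \<and> e \<notin> Pos S"
    "e \<in> B \<longleftrightarrow> (e \<in> A \<or> e \<in> Pos S) \<and> e \<notin> Neg S"
  using assms unfolding moves_def by blast+

lemma pcellD:
  assumes "pcell M P d S"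
  shows "finite S" "S \<subseteq> C" "wf_set S" "\<And>s. s \<in> S \<Longrightarrow> dim s = d"
  using assms by (cases d; auto simp: well_formed_def)+

lemma level_Neg: "S \<subseteq> C \<Longrightarrow> Neg (lv S (Suc k)) = lv (Neg S) k"
  and level_Pos: "S \<subseteq> C \<Longrightarrow> Pos (lv S (Suc k)) = lv (Pos S) k"
  using face(2) by (fastforce simp: in_Neg in_Pos level_def)+

lemma level_Un: "lv (A \<union> B) k = lv A k \<union> lv B k"
  and level_Diff: "lv (A - B) k = lv A k - lv B k"
  by (auto simp: level_def)

text \<open>Taking faces lowers the dimension by exactly one, so level \<open>k\<close> of the moved
  sets sees only level \<open>Suc k\<close> of \<open>S\<close>.\<close>

lemma moves_levels:
  assumes "S \<subseteq> C"
  shows "mvs S A B \<longleftrightarrow> (\<forall>k. mvs (lv S (Suc k)) (lv A k) (lv B k))"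
proof -
  have eq: "X = Y \<longleftrightarrow> (\<forall>k. lv X k = lv Y k)" for X Y
    unfolding level_def by blast
  have "mvs (lv S (Suc k)) (lv A k) (lv B k) \<longleftrightarrow>
      lv A k = lv ((B \<union> Neg S) - Pos S) k \<and> lv B k = lv ((A \<union> Pos S) - Neg S) k" for k
    unfolding moves_def level_Neg[OF assms] level_Pos[OF assms] level_Un level_Diff by (rule refl)
  then show ?thesis unfolding moves_def eq[of A] eq[of B] by blast
qed

lemma cellD:
  assumes "is_cell C dim mi pl (M, P)"
  shows "M \<subseteq> C" "P \<subseteq> C" "M \<noteq> {}" "P \<noteq> {}" "finite M" "finite P" "wf_set M" "wf_set P"
    "mvs M M P" "mvs P M P"
  using assms unfolding is_cell_def by simp_all

lemma cell_level_moves: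
  assumes "is_cell C dim mi pl (M, P)"
  shows "mvs (lv M (Suc k)) (lv M k) (lv P k)" "mvs (lv P (Suc k)) (lv M k) (lv P k)"
proof -
  note c = cellD[OF assms]
  show "mvs (lv M (Suc k)) (lv M k) (lv P k)"
    using iffD1[OF moves_levels[OF c(1)] c(9)] by (rule spec)
  show "mvs (lv P (Suc k)) (lv M k) (lv P k)"
    using iffD1[OF moves_levels[OF c(2)] c(10)] by (rule spec)
qed

lemma cellI:
  assumes "M \<subseteq> C" "P \<subseteq> C" "M \<noteq> {}" "P \<noteq> {}" "finite M" "finite P"
    and "\<And>k. wf_set (lv M k)" "\<And>k. wf_set (lv P k)"
    and "\<And>k. mvs (lv M (Suc k)) (lv M k) (lv P k)" "\<And>k. mvs (lv P (Suc k)) (lv M k) (lv P k)"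
  shows "is_cell C dim mi pl (M, P)"
proof -
  have wf: "wf_set S" if "\<And>k. wf_set (lv S k)" for S
    unfolding well_formed_def
  proof (intro conjI ballI impI)
    fix x y assume xy: "x \<in> S" "y \<in> S"
    show "x = y" if "dim x = 0 \<and> dim y = 0"
      using \<open>wf_set (lv S 0)\<close> xy that unfolding well_formed_def level_def by simp
    show "perp mi pl {x} {y}" if "0 < dim x \<and> dim y = dim x \<and> x \<noteq> y"
      using \<open>wf_set (lv S (dim x))\<close> xy that unfolding well_formed_def level_def by simp
  qed
  show ?thesis
    unfolding is_cell_def prod.case moves_levels[OF assms(1)] moves_levels[OF assms(2)]
    by (intro conjI allI assms wf)
qed

text \<open>A maximal element of level \<open>Suc k\<close> has a positive face that no element of
  the set consumes; this face survives in \<open>P\<close>.\<close>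

lemma cell_nonempty_step:
  assumes cell: "is_cell C dim mi pl (M, P)" and v: "v \<in> M \<union> P" "dim v = Suc k"
  shows "\<exists>y\<in>P. dim y = k"
proof -
  note c = cellD[OF cell]
  have main: "\<exists>y\<in>P. dim y = k" if S: "S = M \<or> S = P" "v \<in> S" for S
  proof -
    have SC: "S \<subseteq> C" "finite S" using S c by auto
    have mv: "mvs S M P" using S c by auto
    have "lv S (Suc k) \<noteq> {}" "finite (lv S (Suc k))" "lv S (Suc k) \<subseteq> C"
      using S v SC by (auto simp: level_def)
    then obtain s where s: "s \<in> lv S (Suc k)" "\<And>b. b \<in> lv S (Suc k) \<Longrightarrow> \<not> s \<prec> b"
      using finite_has_prec_maximal by meson
    then have sS: "s \<in> S" "dim s = Suc k" "s \<in> C" using SC by (auto simp: level_def)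
    then obtain f where f: "f \<in> pl s" using face_pos(3)[of s] by auto
    have df: "dim f = k" using face(2)[of s f] sS f by simp
    have "f \<notin> Neg S"
    proof
      assume "f \<in> Neg S"
      then obtain b where b: "b \<in> S" "f \<in> mi b" by (auto simp: in_Neg)
      then have "dim b = Suc k" using face(2)[of b f] SC df by auto
      then have "b \<in> lv S (Suc k)" using b by (simp add: level_def)
      then show False using s(2) precI[of s b f] b f sS SC by blast
    qed
    moreover have "f \<in> Pos S" using f sS by (auto simp: in_Pos)
    ultimately have "f \<in> P" using mv unfolding moves_def by blast
    then show ?thesis using df by blast
  qed
  then show ?thesis using v by blast
qed

lemma cell_nonempty_below:
  assumes cell: "is_cell C dim mi pl (M, P)"
  shows "v \<in> M \<union> P \<Longrightarrow> k < dim v \<Longrightarrow> \<exists>y\<in>P. dim y = k"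
proof (induction "dim v" arbitrary: v)
  case (Suc d)
  then obtain y where y: "y \<in> P" "dim y = d" using cell_nonempty_step[OF cell] by metis
  show ?case
  proof (cases "k = d")
    case False
    then show ?thesis using Suc.hyps(1)[of y] Suc.hyps(2) Suc.prems y by simp
  qed (use y in blast)
qed simp

lemma cell_nonempty_bottom:
  assumes "is_cell C dim mi pl (M, P)"
  shows "\<exists>y\<in>P. dim y = 0"
proof -
  obtain v where "v \<in> P" using cellD(4)[OF assms] by blast
  then show ?thesis using cell_nonempty_below[OF assms, of v 0] by (cases "dim v = 0") auto
qed

text \<open>Only the base case needs an argument: both sides must contain a point. For
  \<open>P\<close> this is obtained by descending through the levels, for \<open>M\<close> by
  duality.\<close>

lemma cell_pcell:
  assumes cell: "is_cell C dim mi pl (M, P)"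
  shows "pcell (lv M) (lv P) k (lv M k) \<and> pcell (lv M) (lv P) k (lv P k)"
proof (induction k)
  case 0
  have single: "\<exists>a\<in>C. dim a = 0 \<and> lv S 0 = {a}"
    if "S \<subseteq> C" "wf_set S" "\<exists>y\<in>S. dim y = 0" for S
    using that unfolding well_formed_def level_def by blast
  have "\<exists>y\<in>P. dim y = 0" "\<exists>y\<in>M. dim y = 0"
    using cell_nonempty_bottom[OF cell]
      parity.cell_nonempty_bottom[OF dual cell_dual[OF cell]] by auto
  then show ?case
    using single cellD[OF cell] by simp
next
  case (Suc k)
  have "wf_set (lv S j)" if "wf_set S" for S j
    using that by (rule wf_subset) (auto simp: level_def)
  then show ?case
    using Suc cellD[OF cell] cell_level_moves[OF cell] by (auto simp: level_def)
qed

section \<open>Splitting off an extremal element\<close>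

definition decomposes :: "nat \<Rightarrow> nat \<Rightarrow> 'a set \<Rightarrow> 'a set \<Rightarrow> bool" where
  "decomposes n m M P \<longleftrightarrow> (\<exists>N Q L R.
     is_cell C dim mi pl (N, Q) \<and> is_cell C dim mi pl (L, R) \<and>
     is_ndim dim (N \<union> Q) n \<and> \<not> is_ndim dim (N \<union> Q) m \<and>
     is_ndim dim (L \<union> R) n \<and> \<not> is_ndim dim (L \<union> R) m \<and>
     tgt dim m (L, R) = src dim m (N, Q) \<and>
     (M, P) = comp dim m (N, Q) (L, R))"

text \<open>Well-formedness keeps the faces of \<open>x\<close> apart from faces of the same sign of
  other elements, so \<open>x\<close> can act first and the rest completes the move.\<close>

lemma moves_remove:
  assumes mv: "mvs S A B" and S: "wf_set S" "S \<subseteq> C" and x: "x \<in> S" "mi x \<subseteq> A"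
  shows "mvs (S - {x}) ((A \<union> pl x) - mi x) B"
proof -
  have split: "Neg S = Neg (S - {x}) \<union> mi x" "Pos S = Pos (S - {x}) \<union> pl x"
    using x(1) by (auto simp: in_Neg in_Pos)
  have uniq: "v = x" if "e \<in> mi v \<and> e \<in> mi x \<or> e \<in> pl v \<and> e \<in> pl x" "v \<in> S" for v e
    using wf_unique[OF S(1) that(2) x(1) _ _ that(1)] that(2) x(1) S(2) by blast
  have *: "Neg (S - {x}) \<inter> mi x = {}" "Pos (S - {x}) \<inter> pl x = {}"
    using uniq unfolding disjoint_iff in_Neg in_Pos by blast+
  have "mi x \<inter> pl x = {}" using face_disjoint x(1) S(2) by blast
  then have "e \<in> (A \<union> pl x) - mi x \<longleftrightarrow> (e \<in> B \<or> e \<in> Neg (S - {x})) \<and> e \<notin> Pos (S - {x})"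
    "e \<in> B \<longleftrightarrow> (e \<in> (A \<union> pl x) - mi x \<or> e \<in> Pos (S - {x})) \<and> e \<notin> Neg (S - {x})" for e
    using movesD[OF mv, of e] x(2) * unfolding split by blast+
  then show ?thesis unfolding moves_def by blast
qed

text \<open>All negative faces of \<open>x\<close> are present at the source, so \<open>x\<close>
  can be performed first, as the sole element above dimension \<open>m\<close> of the first factor.
  The element \<open>u\<close> keeps the second factor above dimension \<open>m\<close>.\<close>

lemma decompose_at_source:
  assumes cell: "is_cell C dim mi pl (M, P)" and n: "is_ndim dim (M \<union> P) n" "m < n"
    and x: "x \<in> M" "x \<in> P" "dim x = Suc m" "mi x \<subseteq> M"
    and u: "u \<in> M \<union> P" "u \<noteq> x" "m < dim u"
  shows "decomposes n m M P"
proof -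
  note c = cellD[OF cell]
  have xC: "x \<in> C" using x c by blast
  have mix: "v \<in> C \<and> dim v = m" if "v \<in> mi x \<union> pl x" for v
    using face[OF xC that] x(3) by simp
  have mi_lv: "mi x \<subseteq> lv M m" using x(4) mix by (auto simp: level_def)
  \<comment> \<open>The \<open>m\<close>-level at which the two factors meet: level \<open>m\<close>
    of the source after the move along \<open>x\<close>.\<close>
  define Y where "Y = (lv M m \<union> pl x) - mi x"
  have "pl x \<inter> lv M m = {} \<and> pcell (lv M) (lv P) m Y"
    unfolding Y_def by (rule pcell_step) (use cell_pcell[OF cell] xC x(3) mi_lv in auto)
  then have pY: "pcell (lv M) (lv P) m Y" and disj: "pl x \<inter> lv M m = {}" by blast+
  note Y = pcellD[OF pY]
  have lvs: "lv {x} (Suc m) = {x}" "k \<noteq> Suc m \<Longrightarrow> lv {x} k = {}" for k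
    using x(3) by (auto simp: level_def)
  define N where "N = (M - lv M m - {x}) \<union> Y"
  define Q where "Q = P - {x}"
  define L where "L = {v \<in> M. dim v \<le> m} \<union> {x}"
  define R where "R = {v \<in> P. dim v < m} \<union> Y \<union> {x}"
  have lN: "lv N k = (if k = m then Y else if k = Suc m then lv M k - {x} else lv M k)" for k
    using Y(4) x(3) unfolding N_def level_def by auto
  have lQ: "lv Q k = (if k = Suc m then lv P k - {x} else lv P k)" for k
    using x(3) unfolding Q_def level_def by auto
  have lL: "lv L k = (if k \<le> m then lv M k else if k = Suc m then {x} else {})" for k
    using x(3) unfolding L_def level_def by auto
  have lR: "lv R k = (if k < m then lv P k else if k = m then Y else if k = Suc m then {x} else {})" for k
    using x(3) Y(4) unfolding R_def level_def by auto
  have wfl: "wf_set (lv S k)" "wf_set (lv S k - {x})" if "wf_set S" for S k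
    by (rule wf_subset[OF that], auto simp: level_def)+
  have wf1: "wf_set {x}" "wf_set {}"
    by (auto simp: well_formed_def)
  note mv = cell_level_moves[OF cell]
  have YM: "mvs Y (lv M k) (lv P k)" if "Suc k = m" for k
    using pY that by auto
  have rem: "mvs (lv M (Suc m) - {x}) Y (lv P m)" "mvs (lv P (Suc m) - {x}) Y (lv P m)"
    unfolding Y_def
    using mv[of m] wfl c(1,2,7,8) x mi_lv by (auto intro!: moves_remove simp: level_def)
  have xM: "x \<notin> Neg M" "x \<notin> Pos M" "x \<notin> Neg P" "x \<notin> Pos P"
    using x(1,2) c(9,10) unfolding moves_def by blast+
  have xlv: "x \<notin> Neg (lv M k)" "x \<notin> Pos (lv M k)" "x \<notin> Neg (lv P k)" "x \<notin> Pos (lv P k)" for k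
    using xM unfolding in_Neg in_Pos level_def by blast+
  have top: "mvs (lv M (Suc (Suc m))) (lv M (Suc m) - {x}) (lv P (Suc m) - {x})"
    "mvs (lv P (Suc (Suc m))) (lv M (Suc m) - {x}) (lv P (Suc m) - {x})"
    using mv[of "Suc m"] xlv[of "Suc (Suc m)"] unfolding moves_def by blast+
  have xY: "mvs {x} (lv M m) Y"
    using mi_lv disj face_disjoint[OF xC] unfolding moves_def Y_def Sminus_def Splus_def by auto
  have triv: "mvs {} A A" for A
    unfolding moves_def Sminus_def Splus_def by auto
  have plY: "pl x \<subseteq> Y" "pl x \<noteq> {}"
    using face_disjoint[OF xC] face_pos(3)[OF xC] x(3) by (auto simp: Y_def)
  \<comment> \<open>A point of \<open>P\<close> differs from \<open>x\<close>, whose dimension is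
    positive, so removing \<open>x\<close> leaves \<open>Q\<close> non-empty.\<close>
  have "\<exists>y\<in>P. dim y = 0"
    using cell_nonempty_below[OF cell, of x 0] x by auto
  then have Q0: "Q \<noteq> {}" using x(3) unfolding Q_def by (metis Diff_iff empty_iff nat.distinct(1) singletonD)
  have NQ: "is_cell C dim mi pl (N, Q)"
  proof (rule cellI)
    show "N \<subseteq> C" "Q \<subseteq> C" "N \<noteq> {}" "Q \<noteq> {}" "finite N" "finite Q"
      using c Y plY Q0 by (auto simp: N_def Q_def)
    show "wf_set (lv N k)" "wf_set (lv Q k)" for k
      unfolding lN lQ using wfl c(7,8) Y(3) by auto
    show "mvs (lv N (Suc k)) (lv N k) (lv Q k)" "mvs (lv Q (Suc k)) (lv N k) (lv Q k)" for k
      using YM[of k] rem top mv[of k] unfolding lN lQ by auto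
  qed
  have LR: "is_cell C dim mi pl (L, R)"
  proof (rule cellI)
    show "L \<subseteq> C" "R \<subseteq> C" "L \<noteq> {}" "R \<noteq> {}" "finite L" "finite R"
      using c Y xC by (auto simp: L_def R_def)
    show "wf_set (lv L k)" "wf_set (lv R k)" for k
      unfolding lL lR using wfl wf1 c(7,8) Y(3) by auto
    show "mvs (lv L (Suc k)) (lv L k) (lv R k)" "mvs (lv R (Suc k)) (lv L k) (lv R k)" for k
      using YM[of k] xY triv mv[of k] unfolding lL lR by (auto simp: not_less_eq less_Suc_eq_le)
  qed
  have dims: "is_ndim dim (N \<union> Q) n" "is_ndim dim (L \<union> R) n"
    using n x(3) Y(4) unfolding is_ndim_def N_def Q_def L_def R_def by auto
  have "u \<in> N \<union> Q" using u by (auto simp: N_def Q_def level_def)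
  then have ndims: "\<not> is_ndim dim (N \<union> Q) m" "\<not> is_ndim dim (L \<union> R) m"
    using u(3) x(3) unfolding is_ndim_def L_def by force+
  have bel: "below dim N m = below dim M m" "below dim L m = below dim M m"
    "below dim Q m = below dim P m" "below dim R m = below dim P m"
    using x(3) Y(4) unfolding below_def N_def L_def Q_def R_def level_def by auto
  have tgt: "tgt dim m (L, R) = src dim m (N, Q)"
    unfolding tgt_def src_def prod.case bel lR lN by simp
  have "M = L \<union> (N - lv N m)"
    unfolding lN using x(1) Y(4) by (auto simp: L_def N_def level_def)
  moreover have "P = (R - lv R m) \<union> Q"
    unfolding lR using x(2,3) Y(4)[of x] by (auto simp: R_def Q_def level_def)
  ultimately have "(M, P) = comp dim m (N, Q) (L, R)"
    by (simp add: comp_def)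
  then show ?thesis
    unfolding decomposes_def using NQ LR dims ndims tgt by blast
qed

text \<open>Reversal exchanges source and target, so the two factors trade places in the
  composite.\<close>

lemma decomposes_dual:
  assumes "parity.decomposes C dim pl mi n m P M"
  shows "decomposes n m M P"
proof -
  obtain N Q L R where *: "is_cell C dim pl mi (N, Q)" "is_cell C dim pl mi (L, R)"
     "is_ndim dim (N \<union> Q) n" "\<not> is_ndim dim (N \<union> Q) m"
     "is_ndim dim (L \<union> R) n" "\<not> is_ndim dim (L \<union> R) m"
     "tgt dim m (L, R) = src dim m (N, Q)"
     "(P, M) = comp dim m (N, Q) (L, R)"
    using assms unfolding parity.decomposes_def[OF dual] by blast
  have "is_cell C dim mi pl (R, L)" "is_cell C dim mi pl (Q, N)"
    using * parity.cell_dual[OF dual] by blast+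
  moreover have "tgt dim m (Q, N) = src dim m (R, L)"
    using *(7) unfolding tgt_def src_def by simp
  moreover have "(M, P) = comp dim m (R, L) (Q, N)"
    using *(8) unfolding comp_def by auto
  ultimately show ?thesis
    unfolding decomposes_def using *(3-6) by (metis Un_commute)
qed

lemma decompose_at_target:
  assumes "is_cell C dim mi pl (M, P)" "is_ndim dim (M \<union> P) n" "m < n"
    and "x \<in> M" "x \<in> P" "dim x = Suc m" "pl x \<subseteq> P"
    and "u \<in> M \<union> P" "u \<noteq> x" "m < dim u"
  shows "decomposes n m M P"
  by (rule decomposes_dual, rule parity.decompose_at_source[OF dual, of _ _ _ _ x u])
    (use assms cell_dual in \<open>auto simp: Un_commute\<close>)

section \<open>The levels of \<open>mu\<close> and \<open>pi\<close>\<close>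

lemma Smp_iterate:
  assumes "u \<in> C" "i \<le> dim u" "y \<in> (Smp mi pl ^^ i) {u}"
  shows "y \<in> C" "dim y = dim u - i"
proof -
  have "y \<in> C \<and> dim y + i = dim u" using assms(3,2)
  proof (induction i arbitrary: y)
    case (Suc i)
    then obtain w where w: "w \<in> (Smp mi pl ^^ i) {u}" "y \<in> mi w"
      unfolding funpow.simps o_apply Smp_def[of mi pl "(Smp mi pl ^^ i) {u}"] Diff_iff in_Neg by blast
    then have "w \<in> C" "dim w + i = dim u" using Suc by auto
    then show ?case using face[of w y] w by simp
  qed (use assms in simp)
  then show "y \<in> C" "dim y = dim u - i" by auto
qed

text \<open>Each iteration lowers the dimension by one, so the dimension test in \<open>mu\<close>
  discards nothing from the iterate.\<close>

lemma level_mu: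
  assumes "u \<in> C" "k \<le> dim u"
  shows "lv (mu dim mi pl u) k = (Smp mi pl ^^ (dim u - k)) {u}"
proof -
  have "dim y = k" if "y \<in> (Smp mi pl ^^ (dim u - k)) {u}" for y
    using Smp_iterate(2)[OF assms(1) _ that] assms(2) by simp
  then show ?thesis using assms(2) unfolding level_def mu_def by blast
qed

lemma level_mu_top:
  assumes "u \<in> C"
  shows "lv (mu dim mi pl u) (dim u) = {u}"
  using level_mu[OF assms order_refl] by simp

lemma level_mu_Suc:
  assumes "u \<in> C" "k < dim u"
  shows "lv (mu dim mi pl u) k = Neg (lv (mu dim mi pl u) (Suc k)) - Pos (lv (mu dim mi pl u) (Suc k))"
proof -
  have "dim u - k = Suc (dim u - Suc k)" using assms by simp
  then show ?thesis
    using level_mu[OF assms(1), of k] level_mu[OF assms(1), of "Suc k"] assms(2)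
    by (simp add: Smp_def)
qed

lemma mu_dual: "mu dim pl mi u = pi dim mi pl u"
proof -
  have "Smp pl mi = Spm mi pl"
    by (intro ext) (simp add: Smp_def Spm_def Sminus_def Splus_def)
  then show ?thesis by (simp add: mu_def pi_def)
qed

lemma level_pi_top: "u \<in> C \<Longrightarrow> lv (pi dim mi pl u) (dim u) = {u}"
  using parity.level_mu_top[OF dual] by (simp add: mu_dual)

lemma level_pi_Suc:
  "u \<in> C \<Longrightarrow> k < dim u \<Longrightarrow>
    lv (pi dim mi pl u) k = Pos (lv (pi dim mi pl u) (Suc k)) - Neg (lv (pi dim mi pl u) (Suc k))"
  using parity.level_mu_Suc[OF dual] by (simp add: mu_dual Sminus_def Splus_def)

section \<open>Chains inside a level and tightness\<close>

text \<open>Since \<open>\<lhd>\<close> ranges over all of \<open>C\<close>, extremal elements are sought along chains that stay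
  inside \<open>S\<close>.\<close>

definition chain :: "'a set \<Rightarrow> 'a \<Rightarrow> 'a \<Rightarrow> bool" where
  "chain S = (\<lambda>a b. a \<in> S \<and> b \<in> S \<and> a \<prec> b)\<^sup>*\<^sup>*"

lemma chain_tri: "chain S a b \<Longrightarrow> a \<unlhd> b"
  unfolding chain_def tri_def by (erule rtranclp_mono[THEN predicate2D, rotated]) blast

lemma chain_maximal:
  assumes "finite S" "S \<subseteq> C" "w \<in> S"
  shows "\<exists>y\<in>S. chain S w y \<and> (\<forall>b\<in>S. \<not> y \<prec> b)"
proof -
  let ?D = "{y \<in> S. chain S w y}"
  have "w \<in> ?D" using assms by (simp add: chain_def)
  then have "finite ?D" "?D \<noteq> {}" "?D \<subseteq> C" using assms by auto
  then obtain y where y: "y \<in> ?D" "\<And>b. b \<in> ?D \<Longrightarrow> \<not> y \<prec> b"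
    using finite_has_prec_maximal by meson
  have "\<not> y \<prec> b" if "b \<in> S" for b
  proof
    assume "y \<prec> b"
    then have "chain S w b" using y(1) that unfolding chain_def
      by (auto intro: rtranclp.rtrancl_into_rtrancl)
    then show False using y(2)[of b] that \<open>y \<prec> b\<close> by simp
  qed
  then show ?thesis using y by blast
qed

lemma chain_dual: "parity.chain C pl mi S x y = chain S y x"
proof -
  have "(\<lambda>a b. a \<in> S \<and> b \<in> S \<and> prec C pl mi a b) = (\<lambda>a b. a \<in> S \<and> b \<in> S \<and> a \<prec> b)\<inverse>\<inverse>"
    by (auto simp: fun_eq_iff prec_dual)
  then show ?thesis
    unfolding parity.chain_def[OF dual] chain_def by (simp add: rtranclp_conversep)
qed

lemma chain_minimal:
  assumes "finite S" "S \<subseteq> C" "w \<in> S"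
  shows "\<exists>x\<in>S. chain S x w \<and> (\<forall>b\<in>S. \<not> b \<prec> x)"
  using parity.chain_maximal[OF dual assms] by (simp add: chain_dual prec_dual)

lemma chain_exit:
  assumes "chain S x w" "x \<in> R" "w \<notin> R"
  shows "\<exists>z z'. z \<in> S \<inter> R \<and> z' \<in> S - R \<and> z \<prec> z' \<and> chain S z' w"
  using assms unfolding chain_def
proof (induction rule: converse_rtranclp_induct)
  case (step y z)
  then show ?case by (cases "z \<in> R") blast+
qed simp

lemma level_tight_convex:
  assumes S: "wf_set S" "S \<subseteq> C" "lv R (Suc m) \<subseteq> S" "\<And>s. s \<in> S \<Longrightarrow> dim s = Suc m"
    and R: "tight C mi pl R" "R \<subseteq> C"
    and xwy: "chain S x w" "chain S w y" "x \<in> R" "y \<in> R"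
  shows "w \<in> R"
proof (rule ccontr)
  assume "w \<notin> R"
  then obtain z z' where z: "z \<in> S \<inter> R" "z' \<in> S - R" "z \<prec> z'" "chain S z' w"
    using chain_exit xwy(1,3) by meson
  have zy: "z' \<unlhd> y" using tri_trans[OF chain_tri[OF z(4)] chain_tri[OF xwy(2)]] .
  obtain e where e: "e \<in> pl z" "e \<in> mi z'" using z(3) unfolding prec_def by blast
  have z'C: "z' \<in> C" using z S(2) by blast
  have "e \<in> Pos R" using e(1) z(1) unfolding in_Pos by blast
  \<comment> \<open>An element of \<open>R\<close> with negative face \<open>e\<close> has dimension
    \<open>Suc m\<close>, hence lies in \<open>S\<close>; by well-formedness it is
    \<open>z'\<close>, which is outside \<open>R\<close>.\<close>
  moreover have "e \<notin> Neg R"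
  proof
    assume "e \<in> Neg R"
    then obtain v where v: "v \<in> R" "e \<in> mi v" unfolding in_Neg by blast
    have vC: "v \<in> C" using v R(2) by blast
    have "dim v = Suc m"
      using face(2)[OF vC] face(2)[OF z'C] v(2) e(2) S(4) z(2) by (metis DiffD1 UnI1)
    then have "v \<in> S" using v S(3) by (auto simp: level_def)
    then have "v = z'" using wf_unique[OF S(1)] z(2) vC z'C v(2) e(2) by blast
    then show False using v z(2) by blast
  qed
  ultimately have "e \<in> Spm mi pl R" by (simp add: Spm_def)
  moreover have "mi z' \<inter> Spm mi pl R = {}"
    using R zy z'C xwy(4) unfolding tight_def by blast
  ultimately show False using e(2) by blast
qed

section \<open>Excision of extremals\<close>

lemma mu_subset: "u \<in> C \<Longrightarrow> mu dim mi pl u \<subseteq> C"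
  unfolding mu_def using Smp_iterate(1)[OF _ diff_le_self] by blast

text \<open>At the top, \<open>M\<close> and \<open>P\<close> agree since nothing lies above. Below
  it, level \<open>Suc j\<close> is that of \<open>mu\<close> or \<open>pi\<close>, so its outer
  faces are \<open>mu\<close> or \<open>pi\<close> at level \<open>j\<close>; the remaining elements
  are untouched by the moves and hence common to both sides.\<close>

lemma cell_level_outside:
  assumes cell: "is_cell C dim mi pl (M, P)" and n: "is_ndim dim (M \<union> P) n"
    and u: "u \<in> M" "dim u = n"
    and j: "j \<le> n"
    and above: "\<And>k. j < k \<Longrightarrow> k \<le> n \<Longrightarrow>
      lv M k = lv (mu dim mi pl u) k \<and> lv P k = lv (pi dim mi pl u) k"
  shows "lv (mu dim mi pl u) j \<subseteq> lv M j" "lv (pi dim mi pl u) j \<subseteq> lv P j"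
    "lv M j - lv (mu dim mi pl u) j = lv P j - lv (pi dim mi pl u) j"
proof -
  note c = cellD[OF cell]
  have uC: "u \<in> C" using u c by blast
  have "lv (mu dim mi pl u) j \<subseteq> lv M j \<and> lv (pi dim mi pl u) j \<subseteq> lv P j \<and>
    lv M j - lv (mu dim mi pl u) j = lv P j - lv (pi dim mi pl u) j"
  proof (cases "j = n")
    case True
    have "dim v \<noteq> Suc n" if "v \<in> M" for v
      using n that unfolding is_ndim_def by (metis UnI1 Suc_n_not_le_n)
    then have "lv M (Suc n) = {}" unfolding level_def by blast
    then have "mvs {} (lv M n) (lv P n)"
      using cell_level_moves(1)[OF cell, of n] by simp
    then have "lv M n = lv P n" using movesD(1) unfolding in_Neg in_Pos by blast
    moreover have "u \<in> lv M n" using u by (simp add: level_def)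
    ultimately show ?thesis
      using True level_mu_top[OF uC] level_pi_top[OF uC] u(2) by simp
  next
    case False
    then have jn: "j < n" "Suc j \<le> n" using j by auto
    have "lv M (Suc j) = lv (mu dim mi pl u) (Suc j)" "lv P (Suc j) = lv (pi dim mi pl u) (Suc j)"
      using above[of "Suc j"] jn by auto
    then have "lv (mu dim mi pl u) j = Neg (lv M (Suc j)) - Pos (lv M (Suc j))"
      "lv (pi dim mi pl u) j = Pos (lv P (Suc j)) - Neg (lv P (Suc j))"
      using level_mu_Suc[OF uC, of j] level_pi_Suc[OF uC, of j] u(2) jn by simp_all
    then show ?thesis
      using cell_level_moves[OF cell, of j] unfolding moves_def by blast
  qed
  then show "lv (mu dim mi pl u) j \<subseteq> lv M j" "lv (pi dim mi pl u) j \<subseteq> lv P j"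
    "lv M j - lv (mu dim mi pl u) j = lv P j - lv (pi dim mi pl u) j" by blast+
qed

theorem excision_of_extremals:
  assumes tight: "\<forall>x\<in>C. tight C mi pl (mu dim mi pl x)"
    and cell: "is_cell C dim mi pl (M, P)" and n: "is_ndim dim (M \<union> P) n"
    and u: "u \<in> M" "dim u = n"
    and ne: "(M, P) \<noteq> (mu dim mi pl u, pi dim mi pl u)"
  shows "\<exists>m<n. decomposes n m M P"
proof -
  note c = cellD[OF cell]
  have uC: "u \<in> C" using u c by blast
  let ?m = "mu dim mi pl u" and ?p = "pi dim mi pl u"
  define Diff where "Diff = {k. k \<le> n \<and> (lv M k \<noteq> lv ?m k \<or> lv P k \<noteq> lv ?p k)}"
  have big: "lv M k = {} \<and> lv P k = {} \<and> lv ?m k = {} \<and> lv ?p k = {}" if "\<not> k \<le> n" for k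
    using that n u(2) unfolding level_def is_ndim_def mu_def pi_def by auto
  have "Diff \<noteq> {}"
  proof
    assume "Diff = {}"
    then have eq: "lv M k = lv ?m k \<and> lv P k = lv ?p k" for k
      using big[of k] unfolding Diff_def by (cases "k \<le> n") auto
    have "v \<in> M \<longleftrightarrow> v \<in> ?m" "v \<in> P \<longleftrightarrow> v \<in> ?p" for v
      using eq[of "dim v"] unfolding level_def by blast+
    then show False using ne by blast
  qed
  moreover have finD: "finite Diff" by (simp add: Diff_def)
  moreover define j where "j = Max Diff"
  ultimately have jD: "j \<in> Diff" using Max_in by blast
  then have jn: "j \<le> n" by (simp add: Diff_def)
  have above: "lv M k = lv ?m k \<and> lv P k = lv ?p k" if "j < k" "k \<le> n" for k
  proof -
    have "k \<notin> Diff" using Max_ge[OF finD, of k] that(1) unfolding j_def by linarith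
    then show ?thesis using that(2) unfolding Diff_def by blast
  qed
  note out = cell_level_outside[OF cell n u jn above]
  \<comment> \<open>Without such an element both levels would agree with those of \<open>mu\<close>
    and \<open>pi\<close>, against the choice of \<open>j\<close>.\<close>
  obtain w where w: "w \<in> lv M j" "w \<notin> lv ?m j" "w \<in> lv P j" "w \<notin> lv ?p j"
    using jD out unfolding Diff_def by blast
  have sub: "lv M k \<subseteq> C" "finite (lv M k)" "wf_set (lv M k)" for k
    using c by (auto simp: level_def intro: wf_subset[OF c(7)])
  have "j \<noteq> 0"
  proof
    assume j0: "j = 0"
    have "lv M 0 \<subseteq> {w}"
      using c(7) w(1) j0 unfolding well_formed_def level_def by blast
    then have m0: "lv ?m 0 = {}" using out(1) w(2) j0 by blast
    have "n \<noteq> 0" using m0 level_mu_top[OF uC] u(2) by (metis insert_not_empty)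
    then have "lv ?m 0 = Neg (lv M 1) - Pos (lv M 1)"
      using level_mu_Suc[OF uC, of 0] u(2) above[of 1] j0 by simp
    moreover have "lv M 1 \<noteq> {}"
    proof (cases "n = 1")
      case True
      then show ?thesis using u by (auto simp: level_def)
    next
      case False
      then have "\<exists>y\<in>M. dim y = 1"
        using parity.cell_nonempty_below[OF dual cell_dual[OF cell], of u 1] u \<open>n \<noteq> 0\<close> by auto
      then show ?thesis by (auto simp: level_def)
    qed
    \<comment> \<open>A minimal element of level 1 has a negative face that nothing in that level
      produces; this face would belong to \<open>mu\<close> in dimension 0.\<close>
    then obtain s where s: "s \<in> lv M 1" "\<And>b. b \<in> lv M 1 \<Longrightarrow> \<not> b \<prec> s"
      using chain_minimal[OF sub(2,1)] by blast
    then have sC: "s \<in> C" "dim s = 1" using sub by (auto simp: level_def)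
    then obtain f where f: "f \<in> mi s" using face_pos(2)[of s] by auto
    then have "f \<notin> Pos (lv M 1)" using s precI[of _ s f] sC sub(1)[of 1] unfolding in_Pos by blast
    moreover have "f \<in> Neg (lv M 1)" using f s unfolding in_Neg by blast
    ultimately show False using m0 by blast
  qed
  then obtain m where j: "j = Suc m" by (cases j) auto
  have mn: "m < n" using jn j by simp
  let ?S = "lv M (Suc m)"
  have memb: "v \<in> C \<and> dim v = Suc m \<and> v \<in> M" if "v \<in> ?S" for v
    using that sub(1) by (auto simp: level_def)
  have outP: "v \<in> P" if "v \<in> ?S" "v \<notin> ?m" for v
    using out(3) that unfolding j level_def by blast
  \<comment> \<open>Since \<open>u\<close> lies in its own \<open>mu\<close>, it differs from any
    element split off outside \<open>mu\<close> and keeps the other factor above dimension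
    \<open>m\<close>.\<close>
  have uv: "u \<in> M \<union> P" "u \<noteq> v" "m < dim u" if "v \<in> ?S" "v \<notin> ?m" for v
    using that u mn by (auto simp: mu_def)
  have mv: "mvs ?S (lv M m) (lv P m)" using cell_level_moves(1)[OF cell] .
  obtain x where x: "x \<in> ?S" "chain ?S x w" "\<And>b. b \<in> ?S \<Longrightarrow> \<not> b \<prec> x"
    using chain_minimal[OF sub(2,1)] w(1) unfolding j by blast
  obtain y where y: "y \<in> ?S" "chain ?S w y" "\<And>b. b \<in> ?S \<Longrightarrow> \<not> y \<prec> b"
    using chain_maximal[OF sub(2,1)] w(1) unfolding j by blast
  have wm: "w \<notin> ?m" using w(1,2) unfolding level_def by blast
  have "x \<notin> ?m \<or> y \<notin> ?m"
  proof (rule ccontr)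
    assume "\<not> ?thesis"
    then have "w \<in> ?m"
      using level_tight_convex[OF sub(3,1) _ _ _ mu_subset[OF uC] x(2) y(2)] out(1) tight uC memb
      unfolding j by blast
    then show False using wm by blast
  qed
  then show ?thesis
  proof
    assume xm: "x \<notin> ?m"
    \<comment> \<open>By minimality no negative face of \<open>x\<close> is produced inside the
      level, so all of them are already in the source.\<close>
    have "mi x \<inter> Pos ?S = {}"
      unfolding disjoint_iff in_Pos using x(1,3) memb precI by blast
    moreover have "mi x \<subseteq> Neg ?S" unfolding Sminus_def using x(1) by blast
    ultimately have "mi x \<subseteq> M" using mv unfolding moves_def level_def by blast
    then have "decomposes n m M P"
      using decompose_at_source[OF cell n mn _ outP[OF x(1) xm] _ _ uv[OF x(1) xm]] memb[OF x(1)]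
      by blast
    then show ?thesis using mn by blast
  next
    assume ym: "y \<notin> ?m"
    have "pl y \<inter> Neg ?S = {}"
      unfolding disjoint_iff in_Neg using y(1,3) memb precI by blast
    moreover have "pl y \<subseteq> Pos ?S" unfolding Splus_def using y(1) by blast
    ultimately have "pl y \<subseteq> P" using mv unfolding moves_def level_def by blast
    then have "decomposes n m M P"
      using decompose_at_target[OF cell n mn _ outP[OF y(1) ym] _ _ uv[OF y(1) ym]] memb[OF y(1)]
      by blast
    then show ?thesis using mn by blast
  qed
qed

end

theorem theorem4p1:
  fixes C :: "'a set" and dim :: "'a \<Rightarrow> nat" and mi pl :: "'a \<Rightarrow> 'a set"
    and M P :: "'a set" and u :: 'a and n :: nat
  assumes "parity_complex C dim mi pl"
    and "\<forall>x\<in>C. tight C mi pl (mu dim mi pl x)"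
    and "is_cell C dim mi pl (M, P)"
    and "is_ndim dim (M \<union> P) n"
    and "u \<in> M" and "dim u = n"
    and "(M, P) \<noteq> (mu dim mi pl u, pi dim mi pl u)"
  shows "\<exists>m < n. \<exists>N Q L R.
           is_cell C dim mi pl (N, Q) \<and> is_cell C dim mi pl (L, R) \<and>
           is_ndim dim (N \<union> Q) n \<and> \<not> is_ndim dim (N \<union> Q) m \<and>
           is_ndim dim (L \<union> R) n \<and> \<not> is_ndim dim (L \<union> R) m \<and>
           tgt dim m (L, R) = src dim m (N, Q) \<and>
           (M, P) = comp dim m (N, Q) (L, R)"
proof -
  interpret parity C dim mi pl
    by unfold_locales (rule assms)
  show ?thesis
    using excision_of_extremals[OF assms(2-7)] unfolding decomposes_def .
qed

end
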